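(* The functions $\epsilon(\cdot,\cdot)$, on pairs of partitions of the spatial domain $\mathcal D$, and $\epsilon_n(\cdot,\cdot)$, on pairs of partitions of the set $\mathcal S$ of $n$ observed locations, defined in the context, are distances, in the sense that they satisfy the axioms for a distance: non-negativity, the identity of indiscernibles, symmetry, and the triangle inequality.
   Context: $\mathcal D=[0,1]^2$ is the spatial domain and $\mathcal S=\{\boldsymbol s_1,\dots,\boldsymbol s_n\}\subset\mathcal D$ is the set of observed locations; $|\cdot|$ denotes area for spatial domains and cardinality for finite sets. For two spatial domain partitions $\pi_1(\mathcal D)=\{\mathcal D_{11},\dots,\mathcal D_{1k_1}\}$ and $\pi_2(\mathcal D)=\{\mathcal D_{21},\dots,\mathcal D_{2k_2}\}$ of $\mathcal D$ into disjoint sub-domains, with $k_1$ and $k_2$ clusters respectively, $$\epsilon\{\pi_1(\mathcal D),\pi_2(\mathcal D)\}=2-|\mathcal D|^{-1}\Big[\sum_{j=1}^{k_1}\max_{l\in\{1,\dots,k_2\}}|\mathcal D_{1j}\cap\mathcal D_{2l}|+\sum_{l=1}^{k_2}\max_{j\in\{1,\dots,k_1\}}|\mathcal D_{1j}\cap\mathcal D_{2l}|\Big].$$ For two partitions $\pi_1(\mathcal S)=\{\mathcal S_{11},\dots,\mathcal S_{1k_1}\}$ and $\pi_2(\mathcal S)=\{\mathcal S_{21},\dots,\mathcal S_{2k_2}\}$ of $\mathcal S$, with $k_1$ and $k_2$ clusters respectively, $$\epsilon_n\{\pi_1(\mathcal S),\pi_2(\mathcal S)\}=2-n^{-1}\Big[\sum_{j=1}^{k_1}\max_{l\in\{1,\dots,k_2\}}|\mathcal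 S_{1j}\cap\mathcal S_{2l}|+\sum_{l=1}^{k_2}\max_{j\in\{1,\dots,k_1\}}|\mathcal S_{1j}\cap\mathcal S_{2l}|\Big].$$
   Formalization: For partitions of the spatial domain, the identity of indiscernibles is stated up to sets of area zero: the distance is 0 exactly when the partitions coincide after deleting a common null set (dropping emptied cells); literally it fails, e.g. when a boundary segment is moved to another cell. *)

theory Defs
  imports "HOL-Analysis.Analysis"
begin

definition spatial_domain :: "(real \<times> real) set" where
  "spatial_domain = {0..1} \<times> {0..1}"

abbreviation area :: "(real \<times> real) set \<Rightarrow> real" where
  "area A \<equiv> measure lebesgue A"

text \<open>Sub-domains are Lebesgue measurable, so that their areas make sense. Cells of area zero are
  not excluded.\<close>

definition domain_partitions :: "(real \<times> real) set set set" where
  "domain_partitions =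
     {P. finite P \<and> partition_on spatial_domain P \<and> P \<subseteq> sets lebesgue}"

definition set_partitions :: "'a set \<Rightarrow> 'a set set set" where
  "set_partitions S = {P. partition_on S P}"

definition eps :: "(real \<times> real) set set \<Rightarrow> (real \<times> real) set set \<Rightarrow> real" where
  "eps P Q = 2 - inverse (area spatial_domain) *
     ((\<Sum>A\<in>P. MAX B\<in>Q. area (A \<inter> B)) + (\<Sum>B\<in>Q. MAX A\<in>P. area (A \<inter> B)))"

definition eps_n :: "'a set \<Rightarrow> 'a set set \<Rightarrow> 'a set set \<Rightarrow> real" where
  "eps_n S P Q = 2 - inverse (real (card S)) *
     ((\<Sum>A\<in>P. MAX B\<in>Q. real (card (A \<inter> B))) + (\<Sum>B\<in>Q. MAX A\<in>P. real (card (A \<inter> B))))"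

text \<open>Areas do not see null sets: \<open>eps\<close> vanishes on two partitions that differ only in the cell to
  which, say, a boundary segment is allotted. Domain partitions are therefore identified when
  deleting one common null set from all cells (and dropping cells that become empty) makes them
  the same partition.\<close>

definition ae_equal :: "(real \<times> real) set set \<Rightarrow> (real \<times> real) set set \<Rightarrow> bool" where
  "ae_equal P Q \<longleftrightarrow>
     (\<exists>N \<in> null_sets lebesgue. (\<lambda>A. A - N) ` P - {{}} = (\<lambda>B. B - N) ` Q - {{}})"

text \<open>The axioms of a distance on \<open>M\<close>, where \<open>E\<close> is the notion of equality used in the identity of
  indiscernibles. (The library locale \<^locale>\<open>Metric_space\<close> demands non-negativity and symmetry also
  outside the carrier, and only admits \<open>(=)\<close>.)\<close>

definition distance_on :: "'b set \<Rightarrow> ('b \<Rightarrow> 'b \<Rightarrow> bool) \<Rightarrow> ('b \<Rightarrow> 'b \<Rightarrow> real) \<Rightarrow> bool" where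
  "distance_on M E d \<longleftrightarrow>
     (\<forall>x\<in>M. \<forall>y\<in>M. 0 \<le> d x y) \<and>
     (\<forall>x\<in>M. \<forall>y\<in>M. d x y = 0 \<longleftrightarrow> E x y) \<and>
     (\<forall>x\<in>M. \<forall>y\<in>M. d x y = d y x) \<and>
     (\<forall>x\<in>M. \<forall>y\<in>M. \<forall>z\<in>M. d x z \<le> d x y + d y z)"

end

theory Submission
  imports Defs
begin

text \<open>Both functions are instances of one construction over a measure (Lebesgue measure and counting
  measure). Let the overlap of \<open>P\<close> with \<open>Q\<close> be the sum over the cells of \<open>P\<close> of the largest measure
  of an intersection with a cell of \<open>Q\<close>, and let \<open>f\<close> and \<open>g\<close> choose maximising cells from \<open>P\<close> to \<open>Q\<close>
  and from \<open>Q\<close> to \<open>R\<close>. The sets \<open>X = (\<Union>A\<in>P. A \<inter> f A)\<close> and \<open>Y = (\<Union>B\<in>Q. B \<inter> g B)\<close> have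
  the overlaps of \<open>P\<close> with \<open>Q\<close> and of \<open>Q\<close> with \<open>R\<close> as their measures, and
  \<open>X \<inter> Y \<subseteq> (\<Union>A\<in>P. A \<inter> g (f A))\<close>; inclusion-exclusion gives the triangle inequality.
  If the distance is \<open>0\<close>, the set \<open>(\<Union>A\<in>P. A - f A) \<union> (\<Union>B\<in>Q. B - g B)\<close>, now with
  \<open>g\<close> from \<open>Q\<close> to \<open>P\<close>, is null, and outside of it \<open>f\<close> and \<open>g\<close> are mutually inverse.\<close>

locale finite_measure_domain =
  fixes M :: "'a measure" and D :: "'a set"
  assumes D_fmeasurable: "D \<in> fmeasurable M"
    and D_pos: "0 < measure M D"
begin

definition partitions :: "'a set set set" where
  "partitions = {P. finite P \<and> partition_on D P \<and> P \<subseteq> sets M}"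

definition overlap :: "'a set set \<Rightarrow> 'a set set \<Rightarrow> real" where
  "overlap P Q = (\<Sum>A\<in>P. MAX B\<in>Q. measure M (A \<inter> B))"

definition overlap_dist :: "'a set set \<Rightarrow> 'a set set \<Rightarrow> real" where
  "overlap_dist P Q = 2 - inverse (measure M D) * (overlap P Q + overlap Q P)"

definition equal_mod_null :: "'a set set \<Rightarrow> 'a set set \<Rightarrow> bool" where
  "equal_mod_null P Q \<longleftrightarrow>
     (\<exists>N \<in> null_sets M. (\<lambda>A. A - N) ` P - {{}} = (\<lambda>B. B - N) ` Q - {{}})"

section \<open>Cells of a partition and their measures\<close>

lemma partitionsD:
  assumes "P \<in> partitions"
  shows "finite P" "\<Union>P = D" "disjoint P" "P \<noteq> {}"
proof -
  show "finite P" "\<Union>P = D" "disjoint P"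
    using assms by (auto simp: partitions_def partition_on_def)
  \<comment> \<open>The empty family would cover only the empty set, which has measure 0. So no
    \<open>MAX\<close> over a partition is taken over the empty set.\<close>
  then show "P \<noteq> {}"
    using D_pos by auto
qed

lemma cell_eq:
  assumes "P \<in> partitions" "A \<in> P" "A' \<in> P" "x \<in> A" "x \<in> A'"
  shows "A = A'"
  using partitionsD(3)[OF assms(1)] assms(2-) by (auto simp: disjoint_def)

lemma cell_fmeasurable:
  assumes "P \<in> partitions" "A \<in> P"
  shows "A \<in> fmeasurable M"
  using assms partitionsD(2)[OF assms(1)]
  by (intro fmeasurableI2[OF D_fmeasurable]) (auto simp: partitions_def)

lemma Int_cell_fmeasurable:
  assumes "P \<in> partitions" "Q \<in> partitions" "A \<in> P" "B \<in> Q"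
  shows "A \<inter> B \<in> fmeasurable M"
  using assms by (meson cell_fmeasurable fmeasurableD fmeasurable_Int_fmeasurable)

lemma measure_Int_cell_le:
  assumes "P \<in> partitions" "Q \<in> partitions" "A \<in> P" "B \<in> Q"
  shows "measure M (A \<inter> B) \<le> measure M A"
  using assms Int_cell_fmeasurable cell_fmeasurable
  by (intro measure_mono_fmeasurable) (auto dest: fmeasurableD)

lemma Max_overlap_attained:
  assumes "Q \<in> partitions"
  obtains f where "\<And>A. f A \<in> Q" "\<And>A. (MAX B\<in>Q. measure M (A \<inter> B)) = measure M (A \<inter> f A)"
proof -
  have "\<exists>B\<in>Q. (MAX B\<in>Q. measure M (A \<inter> B)) = measure M (A \<inter> B)" for A
    using obtains_MAX[OF partitionsD(1,4)[OF assms], of "\<lambda>B. measure M (A \<inter> B)"] by metis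
  then show thesis
    using that by metis
qed

text \<open>Pieces cut out of distinct cells inherit disjointness from the cells. The sum is indexed
  by the cells, so pieces that coincide by being empty do no harm.\<close>

lemma measure_UN_cells:
  assumes "P \<in> partitions" "\<And>A. A \<in> P \<Longrightarrow> f A \<subseteq> A" "\<And>A. A \<in> P \<Longrightarrow> f A \<in> fmeasurable M"
  shows "measure M (\<Union>A\<in>P. f A) = (\<Sum>A\<in>P. measure M (f A))"
proof (rule measure_UNION_AE)
  show "finite P"
    by (rule partitionsD(1)[OF assms(1)])
  show "pairwise (\<lambda>A B. AE x in M. x \<notin> f A \<or> x \<notin> f B) P"
    using cell_eq[OF assms(1)] assms(2) by (fastforce simp: pairwise_def)
qed (rule assms(3))

lemma sum_measure_cells:
  assumes "P \<in> partitions"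
  shows "(\<Sum>A\<in>P. measure M A) = measure M D"
  using measure_UN_cells[OF assms, of "\<lambda>A. A"] cell_fmeasurable[OF assms] partitionsD(2)[OF assms]
  by simp

section \<open>Upper bound and triangle inequality for the overlap\<close>

lemma overlap_le:
  assumes P: "P \<in> partitions" and Q: "Q \<in> partitions"
  shows "overlap P Q \<le> measure M D"
proof -
  obtain f where "\<And>A. f A \<in> Q" "\<And>A. (MAX B\<in>Q. measure M (A \<inter> B)) = measure M (A \<inter> f A)"
    using Max_overlap_attained[OF Q] by blast
  then show ?thesis
    unfolding overlap_def sum_measure_cells[OF P, symmetric]
    using measure_Int_cell_le[OF P Q] by (auto intro: sum_mono)
qed

lemma overlap_triangle:
  assumes P: "P \<in> partitions" and Q: "Q \<in> partitions" and R: "R \<in> partitions"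
  shows "overlap P Q + overlap Q R \<le> measure M D + overlap P R"
proof -
  obtain f where f: "\<And>A. f A \<in> Q" "\<And>A. (MAX B\<in>Q. measure M (A \<inter> B)) = measure M (A \<inter> f A)"
    using Max_overlap_attained[OF Q] by blast
  obtain g where g: "\<And>B. g B \<in> R" "\<And>B. (MAX C\<in>R. measure M (B \<inter> C)) = measure M (B \<inter> g B)"
    using Max_overlap_attained[OF R] by blast
  define X where "X = (\<Union>A\<in>P. A \<inter> f A)"
  define Y where "Y = (\<Union>B\<in>Q. B \<inter> g B)"
  define Z where "Z = (\<Union>A\<in>P. A \<inter> g (f A))"
  note fin = partitionsD(1)[OF P] partitionsD(1)[OF Q]
  have X: "X \<in> fmeasurable M" and Y: "Y \<in> fmeasurable M" and Z: "Z \<in> fmeasurable M"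
    unfolding X_def Y_def Z_def
    using fin Int_cell_fmeasurable[OF P Q] Int_cell_fmeasurable[OF Q R]
      Int_cell_fmeasurable[OF P R] f(1) g(1)
    by (auto intro!: fmeasurable.finite_UN)
  have mX: "measure M X = overlap P Q"
    unfolding X_def overlap_def f(2)
    using Int_cell_fmeasurable[OF P Q] f(1) by (intro measure_UN_cells[OF P]) auto
  have mY: "measure M Y = overlap Q R"
    unfolding Y_def overlap_def g(2)
    using Int_cell_fmeasurable[OF Q R] g(1) by (intro measure_UN_cells[OF Q]) auto
  have "measure M Z = (\<Sum>A\<in>P. measure M (A \<inter> g (f A)))"
    unfolding Z_def
    using Int_cell_fmeasurable[OF P R] g(1) by (intro measure_UN_cells[OF P]) auto
  \<comment> \<open>\<open>g (f A)\<close> is one of the cells competing in the maximum over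
    \<open>R\<close>.\<close>
  also have "\<dots> \<le> overlap P R"
    unfolding overlap_def using partitionsD(1)[OF R] g(1) by (intro sum_mono Max_ge) auto
  finally have mZ: "measure M Z \<le> overlap P R" .
  \<comment> \<open>A point of \<open>A \<inter> f A\<close> and \<open>B \<inter> g B\<close> lies
    in the cells \<open>f A\<close> and \<open>B\<close> of \<open>Q\<close>, so these are equal and
    the point lies in \<open>g (f A)\<close>.\<close>
  have "X \<inter> Y \<subseteq> Z"
    using cell_eq[OF Q] f(1) unfolding X_def Y_def Z_def by blast
  then have "measure M (X \<inter> Y) \<le> measure M Z"
    using X Y Z by (intro measure_mono_fmeasurable) (auto dest: fmeasurableD)
  moreover have "measure M (X \<union> Y) \<le> measure M D"
    using X Y D_fmeasurable partitionsD(2)[OF P] partitionsD(2)[OF Q]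
    by (intro measure_mono_fmeasurable) (auto simp: X_def Y_def dest: fmeasurableD)
  moreover have "measure M X + measure M Y = measure M (X \<union> Y) + measure M (X \<inter> Y)"
    using measure_Un3[OF X Y] by simp
  ultimately show ?thesis
    using mX mY mZ by linarith
qed

section \<open>Vanishing distance and equality modulo null sets\<close>

text \<open>Each summand of the overlap is at most the measure of its cell, and these measures add
  up to that of \<open>D\<close>. Equality of the sums therefore forces equality cell by
  cell.\<close>

lemma overlap_eq_iff:
  assumes P: "P \<in> partitions" and Q: "Q \<in> partitions"
  shows "overlap P Q = measure M D \<longleftrightarrow> (\<forall>A\<in>P. \<exists>B\<in>Q. A - B \<in> null_sets M)"
proof -
  have null_iff: "A - B \<in> null_sets M \<longleftrightarrow> measure M (A \<inter> B) = measure M A" if "A \<in> P" "B \<in> Q" for A B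
  proof -
    note meas = cell_fmeasurable[OF P that(1)] Int_cell_fmeasurable[OF P Q that]
    \<comment> \<open>\<open>measure\<close> is also 0 on sets of infinite measure; finiteness is
      what lets measure 0 imply null.\<close>
    have "A - A \<inter> B \<in> fmeasurable M"
      using meas by (auto intro: fmeasurable_Diff dest: fmeasurableD)
    moreover have "measure M (A - A \<inter> B) = measure M A - measure M (A \<inter> B)"
      using meas by (intro measurable_measure_Diff) (auto dest: fmeasurableD)
    ultimately show ?thesis
      using measure_Int_cell_le[OF P Q that]
      by (auto simp: Diff_Int null_sets_def emeasure_eq_measure2 ennreal_eq_0_iff fmeasurableD)
  qed
  obtain f where f: "\<And>A. f A \<in> Q" "\<And>A. (MAX B\<in>Q. measure M (A \<inter> B)) = measure M (A \<inter> f A)"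
    using Max_overlap_attained[OF Q] by blast
  have f_max: "measure M (A \<inter> B) \<le> measure M (A \<inter> f A)" if "B \<in> Q" for A B
    unfolding f(2)[symmetric] using partitionsD(1)[OF Q] that by (intro Max_ge) auto
  have "overlap P Q = measure M D \<longleftrightarrow> (\<Sum>A\<in>P. measure M A - measure M (A \<inter> f A)) = 0"
    unfolding overlap_def f(2) sum_measure_cells[OF P, symmetric] by (auto simp: sum_subtractf)
  also have "\<dots> \<longleftrightarrow> (\<forall>A\<in>P. measure M (A \<inter> f A) = measure M A)"
    using measure_Int_cell_le[OF P Q] f(1) partitionsD(1)[OF P]
    by (subst sum_nonneg_eq_0_iff) auto
  also have "\<dots> \<longleftrightarrow> (\<forall>A\<in>P. \<exists>B\<in>Q. measure M (A \<inter> B) = measure M A)"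
    using f(1) f_max measure_Int_cell_le[OF P Q] by (metis order_antisym)
  also have "\<dots> \<longleftrightarrow> (\<forall>A\<in>P. \<exists>B\<in>Q. A - B \<in> null_sets M)"
    using null_iff by blast
  finally show ?thesis .
qed

lemma overlap_dist_eq_0_iff:
  assumes "P \<in> partitions" "Q \<in> partitions"
  shows "overlap_dist P Q = 0 \<longleftrightarrow> overlap P Q = measure M D \<and> overlap Q P = measure M D"
proof -
  have "overlap_dist P Q = 0 \<longleftrightarrow> overlap P Q + overlap Q P = 2 * measure M D"
    using D_pos by (auto simp: overlap_dist_def field_simps)
  then show ?thesis
    using overlap_le[OF assms] overlap_le[OF assms(2,1)] by linarith
qed

text \<open>Off \<open>N\<close>, \<open>A\<close> lies in \<open>f A\<close> and \<open>f A\<close>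
  in \<open>g (f A)\<close>. A point of \<open>A\<close> outside \<open>N\<close> thus makes
  \<open>g (f A)\<close> the same cell as \<open>A\<close>, so \<open>A\<close> and
  \<open>f A\<close> agree off \<open>N\<close>. The other inclusion follows by exchanging the roles
  of the partitions.\<close>

lemma image_Diff_subset:
  assumes P: "P \<in> partitions"
    and f: "\<And>A. A \<in> P \<Longrightarrow> f A \<in> Q" "\<And>A. A \<in> P \<Longrightarrow> A - f A \<subseteq> N"
    and g: "\<And>B. B \<in> Q \<Longrightarrow> g B \<in> P" "\<And>B. B \<in> Q \<Longrightarrow> B - g B \<subseteq> N"
  shows "(\<lambda>A. A - N) ` P - {{}} \<subseteq> (\<lambda>B. B - N) ` Q - {{}}"
proof
  fix C assume "C \<in> (\<lambda>A. A - N) ` P - {{}}"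
  then obtain A where A: "A \<in> P" "\<not> A \<subseteq> N" and C: "C = A - N"
    by blast
  then obtain x where x: "x \<in> A" "x \<notin> N"
    by blast
  then have "x \<in> g (f A)"
    using A(1) f[of A] g[of "f A"] by blast
  then have "g (f A) = A"
    using cell_eq[OF P] A x f g by metis
  then have "A - N = f A - N"
    using A f(2)[of A] g(2)[of "f A"] f(1) by blast
  then show "C \<in> (\<lambda>B. B - N) ` Q - {{}}"
    unfolding C using f(1) A by blast
qed

lemma equal_mod_null_imp_cell:
  assumes P: "P \<in> partitions" and Q: "Q \<in> partitions" and N: "N \<in> null_sets M"
    and eq: "(\<lambda>A. A - N) ` P - {{}} = (\<lambda>B. B - N) ` Q - {{}}" and A: "A \<in> P"
  shows "\<exists>B\<in>Q. A - B \<in> null_sets M"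
proof -
  have "\<exists>B\<in>Q. A - B \<subseteq> N"
  proof (cases "A \<subseteq> N")
    \<comment> \<open>Such a cell leaves no trace in the image equation, but any cell of
      \<open>Q\<close> serves.\<close>
    case True
    then show ?thesis
      using partitionsD(4)[OF Q] by blast
  next
    case False
    then have "A - N \<in> (\<lambda>B. B - N) ` Q"
      using eq A by blast
    then show ?thesis
      by blast
  qed
  then show ?thesis
    using N cell_fmeasurable[OF P A] cell_fmeasurable[OF Q]
    by (blast intro: null_sets_subset)
qed

lemma equal_mod_null_iff:
  assumes P: "P \<in> partitions" and Q: "Q \<in> partitions"
  shows "equal_mod_null P Q \<longleftrightarrow>
    (\<forall>A\<in>P. \<exists>B\<in>Q. A - B \<in> null_sets M) \<and> (\<forall>B\<in>Q. \<exists>A\<in>P. B - A \<in> null_sets M)"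
    (is "_ \<longleftrightarrow> ?cells")
proof
  assume "equal_mod_null P Q"
  then show ?cells
    unfolding equal_mod_null_def
    using equal_mod_null_imp_cell[OF P Q] equal_mod_null_imp_cell[OF Q P] by metis
next
  assume ?cells
  then obtain f g where f: "\<And>A. A \<in> P \<Longrightarrow> f A \<in> Q" "\<And>A. A \<in> P \<Longrightarrow> A - f A \<in> null_sets M"
    and g: "\<And>B. B \<in> Q \<Longrightarrow> g B \<in> P" "\<And>B. B \<in> Q \<Longrightarrow> B - g B \<in> null_sets M"
    by metis
  define N where "N = (\<Union>A\<in>P. A - f A) \<union> (\<Union>B\<in>Q. B - g B)"
  have "N \<in> null_sets M"
    unfolding N_def using partitionsD(1)[OF P] partitionsD(1)[OF Q] f(2) g(2)
    by (intro null_sets.Un null_sets.finite_UN) auto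
  moreover have "(\<lambda>A. A - N) ` P - {{}} = (\<lambda>B. B - N) ` Q - {{}}"
  proof (rule equalityI)
    show "(\<lambda>A. A - N) ` P - {{}} \<subseteq> (\<lambda>B. B - N) ` Q - {{}}"
      using f(1) g(1) by (intro image_Diff_subset[OF P, of f Q N g]) (auto simp: N_def)
    show "(\<lambda>B. B - N) ` Q - {{}} \<subseteq> (\<lambda>A. A - N) ` P - {{}}"
      using f(1) g(1) by (intro image_Diff_subset[OF Q, of g P N f]) (auto simp: N_def)
  qed
  ultimately show "equal_mod_null P Q"
    unfolding equal_mod_null_def by blast
qed

theorem distance_on_overlap_dist: "distance_on partitions equal_mod_null overlap_dist"
  unfolding distance_on_def
proof (intro conjI ballI)
  fix P Q assume P: "P \<in> partitions" and Q: "Q \<in> partitions"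
  show "0 \<le> overlap_dist P Q"
    using overlap_le[OF P Q] overlap_le[OF Q P] D_pos by (simp add: overlap_dist_def field_simps)
  show "overlap_dist P Q = 0 \<longleftrightarrow> equal_mod_null P Q"
    using overlap_dist_eq_0_iff[OF P Q] overlap_eq_iff[OF P Q] overlap_eq_iff[OF Q P]
      equal_mod_null_iff[OF P Q] by simp
  show "overlap_dist P Q = overlap_dist Q P"
    by (simp add: overlap_dist_def add.commute)
  fix R assume R: "R \<in> partitions"
  show "overlap_dist P R \<le> overlap_dist P Q + overlap_dist Q R"
  proof -
    \<comment> \<open>\<open>overlap\<close> is not symmetric, so its triangle inequality is used
      along \<open>P\<close>, \<open>Q\<close>, \<open>R\<close> and along \<open>R\<close>,
      \<open>Q\<close>, \<open>P\<close>, and the two are added.\<close>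
    have "inverse (measure M D) * (overlap P Q + overlap Q P + overlap Q R + overlap R Q)
      \<le> inverse (measure M D) * (2 * measure M D + overlap P R + overlap R P)"
      using overlap_triangle[OF P Q R] overlap_triangle[OF R Q P] D_pos
      by (intro mult_left_mono) auto
    then show ?thesis
      using D_pos by (simp add: overlap_dist_def algebra_simps)
  qed
qed

end

section \<open>The Lebesgue and counting instances\<close>

text \<open>For the counting instance, where \<open>equal_mod_null\<close> coincides with
  \<open>(=)\<close> on partitions but ignores an empty member in other families.\<close>

lemma distance_on_cong:
  assumes "distance_on M E d"
    and "\<And>x y. x \<in> M \<Longrightarrow> y \<in> M \<Longrightarrow> E x y \<longleftrightarrow> E' x y"
    and "\<And>x y. x \<in> M \<Longrightarrow> y \<in> M \<Longrightarrow> d x y = d' x y"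
  shows "distance_on M E' d'"
  using assms unfolding distance_on_def by simp

lemma spatial_domain_eq_cbox: "spatial_domain = cbox (0, 0) (1, 1)"
  by (simp add: spatial_domain_def cbox_Pair_eq)

lemma area_spatial_domain: "area spatial_domain = 1"
  by (simp add: spatial_domain_eq_cbox content_Pair)

lemma distance_on_eps: "distance_on domain_partitions ae_equal eps"
proof -
  interpret finite_measure_domain lebesgue spatial_domain
    by unfold_locales (simp_all add: area_spatial_domain, simp add: spatial_domain_eq_cbox)
  have "partitions = domain_partitions" "equal_mod_null = ae_equal"
    by (auto simp: partitions_def domain_partitions_def equal_mod_null_def ae_equal_def fun_eq_iff)
  moreover have "overlap_dist = eps"
    by (simp add: overlap_dist_def overlap_def eps_def fun_eq_iff Int_commute)
  ultimately show ?thesis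
    using distance_on_overlap_dist by simp
qed

lemma distance_on_eps_n:
  assumes "finite S" "S \<noteq> {}"
  shows "distance_on (set_partitions S) (=) (eps_n S)"
proof -
  interpret finite_measure_domain "count_space UNIV" S
    using assms by unfold_locales (auto simp: fmeasurable_def card_gt_0_iff of_nat_less_top)
  have partitions: "partitions = set_partitions S"
    using assms(1) by (auto simp: partitions_def set_partitions_def dest: finite_elements)
  show ?thesis
  proof (rule distance_on_cong[OF distance_on_overlap_dist[unfolded partitions]])
    fix P Q assume "P \<in> set_partitions S" "Q \<in> set_partitions S"
    \<comment> \<open>Only the empty set is null for counting measure and partitions have no empty
      cells, so \<open>equal_mod_null\<close> collapses to equality.\<close>
    then have "P - {{}} = P" "Q - {{}} = Q"
      by (auto simp: set_partitions_def partition_on_def)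
    then show "equal_mod_null P Q \<longleftrightarrow> P = Q"
      by (simp add: equal_mod_null_def null_sets_count_space)
    show "overlap_dist P Q = eps_n S P Q"
      by (simp add: overlap_dist_def overlap_def eps_n_def Measure_Space.measure_count_space Int_commute)
  qed
qed

theorem proposition2:
  fixes S :: "(real \<times> real) set"
  assumes "finite S" and "S \<noteq> {}" and "S \<subseteq> spatial_domain"
  shows "distance_on domain_partitions ae_equal eps \<and>
         distance_on (set_partitions S) (=) (eps_n S)"
  using distance_on_eps distance_on_eps_n[OF assms(1,2)] by blast

end
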